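(* For every positive integer $N$, \[ \prod_{r\in F_N} \frac{\Gamma(r)}{\sqrt{2\pi}} = \left( \operatorname{lcm}[1,2,\dots,N] \right)^{-1/2}, \] where $F_N$ denotes the set of all rational numbers in the open interval $(0,1)$ whose denominator in lowest terms is at most $N$.
   Context: $\Gamma$ is Euler's Gamma function, and $\operatorname{lcm}[1,2,\dots,N]$ is the least common multiple of the integers $1,2,\dots,N$. The set $F_N$ is the Farey sequence of order $N$ with the endpoints $\frac01$ and $\frac11$ excluded; in particular $F_1$ is empty, and an empty product equals $1$. *)

theory Defs
  imports "HOL-Analysis.Analysis"
begin

text \<open>\<open>quotient_of r\<close> is the pair (numerator, denominator) of \<open>r\<close> in lowest
  terms, with positive denominator.\<close>

definition farey :: "nat \<Rightarrow> rat set" where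
  "farey N = {r. 0 < r \<and> r < 1 \<and> snd (quotient_of r) \<le> int N}"

text \<open>Needed because \<open>prod\<close> over an infinite set is \<open>1\<close>.\<close>

lemma finite_farey: "finite (farey N)"
proof (rule finite_subset)
  show "farey N \<subseteq> (\<lambda>(a, b). Fract a b) ` ({0..int N} \<times> {0..int N})"
  proof
    fix r assume r: "r \<in> farey N"
    obtain a b where ab: "quotient_of r = (a, b)" by (cases "quotient_of r")
    have b: "b > 0" "b \<le> int N" and eq: "r = Fract a b"
      using r ab quotient_of_denom_pos[OF ab] quotient_of_div[OF ab]
      by (auto simp: farey_def Fract_of_int_quotient)
    have "0 < a" "a < b"
      using r b eq by (auto simp: farey_def zero_less_Fract_iff Fract_less_one_iff)
    then show "r \<in> (\<lambda>(a, b). Fract a b) ` ({0..int N} \<times> {0..int N})"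
      using b eq by (intro image_eqI[of _ _ "(a, b)"]) auto
  qed
qed simp

end

theory Submission
  imports Defs "HOL-Number_Theory.Prime_Powers"
begin

text \<open>
  The involution \<open>r \<mapsto> 1 - r\<close> and Euler's reflection formula turn the square of the product
  into the inverse of the product of \<open>2 sin (\<pi> r)\<close> over the Farey fractions. Grouping the
  fractions \<open>k/n\<close>, \<open>0 < k < n\<close>, by their reduced denominator \<open>d\<close>, the identity
  \<open>\<Prod>k=1..n-1. 2 sin (\<pi> k/n) = n\<close> says that the logarithms of the partial products with
  denominator exactly \<open>d\<close> sum over the divisors \<open>d\<close> of \<open>n\<close> to \<open>ln n\<close>. The von Mangoldt
  function is determined by this property, and its summatory function is the logarithm of
  \<open>lcm(1,\<dots>,N)\<close>.
\<close>

section \<open>Sine products from roots of unity\<close>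

lemma norm_one_minus_cis: "cmod (1 - cis t) = 2 * \<bar>sin (t / 2)\<bar>"
  using dist_exp_i_1[of t] by (simp add: cis_conv_exp norm_minus_commute)

lemma prod_one_minus_roots_unity:
  assumes "n > 0"
  shows "(\<Prod>z\<in>{z::complex. z ^ n = 1} - {1}. 1 - z) = of_nat n"
proof -
  define A where "A = {z::complex. z ^ n = 1} - {1}"
  define p where "p = (\<Prod>z\<in>A. [:- z, 1:])"
  \<comment> \<open>\<open>p\<close> and \<open>q\<close> are two forms of \<open>(X ^ n - 1) / (X - 1)\<close>; compare them at \<open>1\<close>.\<close>
  define q where "q = (\<Sum>k<n. monom (1::complex) k)"
  have fin: "finite {z::complex. z ^ n = 1}"
    using assms by (intro finite_roots_unity) simp
  have cardA: "card A = n - 1"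
    unfolding A_def using fin card_roots_unity_eq[OF assms] by (simp add: card_Diff_singleton)
  have degp: "degree p = n - 1"
    unfolding p_def by (subst degree_prod_eq_sum_degree) (auto simp: cardA)
  have "lead_coeff p = 1"
    unfolding p_def by (simp add: lead_coeff_prod)
  then have "coeff p (n - 1) = 1" by (simp add: degp)
  moreover have "coeff q (n - 1) = 1"
    using assms by (simp add: q_def coeff_sum)
  moreover have "degree q \<le> n - 1"
    unfolding q_def by (intro degree_sum_le) (auto intro: order.trans[OF degree_monom_le])
  moreover have "poly p z = poly q z" if z: "z \<in> A" for z
  proof -
    have "finite A" using fin by (simp add: A_def)
    then have "poly p z = 0"
      using z by (auto simp: p_def poly_prod prod_zero_iff)
    moreover have "poly q z = 0"
      using z by (simp add: q_def poly_sum poly_monom A_def sum_gp_strict)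
    ultimately show ?thesis by simp
  qed
  \<comment> \<open>The difference \<open>p - q\<close> has degree below \<open>n - 1\<close>, as
    the coefficients there agree, yet it vanishes at the \<open>n - 1\<close> points of
    \<open>A\<close>.\<close>
  ultimately have "p = q"
    using cardA degp by (intro poly_eqI_degree_lead_coeff[where n = "n - 1" and A = A]) auto
  then have "poly p 1 = poly q 1" by simp
  then show ?thesis
    by (simp add: p_def q_def poly_prod poly_sum poly_monom A_def)
qed

text \<open>Take absolute values in the product of \<open>1 - z\<close> over the nontrivial roots of
  unity: each factor is a chord of the unit circle, and the index 0 left out is the root 1.\<close>

lemma prod_sin_multiples:
  assumes "n > 0"
  shows "(\<Prod>k\<in>{1..<n}. 2 * sin (pi * (real k / real n))) = real n"
proof -
  let ?w = "\<lambda>k. cis (2 * pi * real k / real n)"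
  have bij: "bij_betw ?w {..<n} {z. z ^ n = 1}"
    by (rule Complex.bij_betw_roots_unity[OF assms])
  have "bij_betw ?w ({..<n} - {0}) ({z. z ^ n = 1} - {?w 0})"
    using bij assms by (intro bij_betw_DiffI) (auto simp: bij_betw_def)
  then have bij': "bij_betw ?w {1..<n} ({z. z ^ n = 1} - {1})"
    by (simp add: atLeast1_lessThan_eq_remove0)
  have "real n = cmod (\<Prod>z\<in>{z::complex. z ^ n = 1} - {1}. 1 - z)"
    by (simp add: prod_one_minus_roots_unity[OF assms])
  also have "\<dots> = (\<Prod>k\<in>{1..<n}. cmod (1 - ?w k))"
    by (simp add: prod.reindex_bij_betw[OF bij', symmetric] prod_norm)
  also have "\<dots> = (\<Prod>k\<in>{1..<n}. 2 * sin (pi * (real k / real n)))"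
  proof (rule prod.cong[OF refl])
    fix k assume k: "k \<in> {1..<n}"
    have "sin (pi * (real k / real n)) \<ge> 0"
      using k by (intro sin_ge_zero) (auto simp: field_simps)
    then show "cmod (1 - ?w k) = 2 * sin (pi * (real k / real n))"
      by (simp add: norm_one_minus_cis)
  qed
  finally show ?thesis by simp
qed

section \<open>Fractions grouped by reduced denominator\<close>

definition proper_fracs :: "nat \<Rightarrow> rat set" where
  "proper_fracs d = {r. 0 < r \<and> r < 1 \<and> snd (quotient_of r) = int d}"

lemma farey_eq_UN: "farey N = (\<Union>d\<in>{1..N}. proper_fracs d)"
proof (intro subset_antisym subsetI)
  fix r assume r: "r \<in> farey N"
  have "snd (quotient_of r) > 0"
    by (rule quotient_of_denom_pos')
  then show "r \<in> (\<Union>d\<in>{1..N}. proper_fracs d)"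
    using r by (intro UN_I[of "nat (snd (quotient_of r))"]) (auto simp: farey_def proper_fracs_def)
qed (auto simp: farey_def proper_fracs_def)

lemma proper_fracs_disjoint: "d \<noteq> e \<Longrightarrow> proper_fracs d \<inter> proper_fracs e = {}"
  by (auto simp: proper_fracs_def)

lemma finite_proper_fracs: "finite (proper_fracs d)"
  by (rule finite_subset[OF _ finite_farey[of d]]) (auto simp: farey_def proper_fracs_def)

text \<open>Reducing k/n leaves the denominator n / gcd(k, n), a divisor of n; conversely a/d with n
  = d c expands to (a c)/n.\<close>

lemma UN_proper_fracs_dvd:
  assumes "n > 0"
  shows "(\<Union>d\<in>{d. d dvd n}. proper_fracs d) = (\<lambda>k. Fract (int k) (int n)) ` {1..<n}"
proof (intro subset_antisym subsetI)
  fix r assume "r \<in> (\<Union>d\<in>{d. d dvd n}. proper_fracs d)"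
  then obtain d where d: "d dvd n" "0 < r" "r < 1" "snd (quotient_of r) = int d"
    by (auto simp: proper_fracs_def)
  obtain a where a: "quotient_of r = (a, int d)"
    using d(4) by (cases "quotient_of r") auto
  obtain c where c: "n = d * c" using d(1) by auto
  have pos: "d > 0" "c > 0" using assms c by auto
  have r: "r = Fract a (int d)"
    using quotient_of_div[OF a] by (simp add: Fract_of_int_quotient)
  have "0 < a" "a < int d"
    using d pos r by (auto simp: zero_less_Fract_iff Fract_less_one_iff)
  then obtain k where k: "a = int k" "0 < k" "k < d"
    by (metis of_nat_less_iff of_nat_0_less_iff zero_less_imp_eq_int)
  have "r = Fract (int (k * c)) (int n)"
    using pos by (simp add: r k c eq_rat)
  moreover have "k * c \<in> {1..<n}"
    using k pos by (simp add: c Suc_leI)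
  ultimately show "r \<in> (\<lambda>k. Fract (int k) (int n)) ` {1..<n}"
    by blast
next
  fix r assume "r \<in> (\<lambda>k. Fract (int k) (int n)) ` {1..<n}"
  then obtain k where k: "r = Fract (int k) (int n)" "1 \<le> k" "k < n" by auto
  have "snd (quotient_of r) = int (n div gcd k n)"
    using assms by (simp add: k(1) quotient_of_Fract Rat.normalize_def Let_def zdiv_int)
  moreover have "n div gcd k n dvd n"
    by (metis dvd_div_mult_self dvd_triv_left gcd_dvd2)
  moreover have "0 < r" "r < 1"
    using k by (auto simp: zero_less_Fract_iff Fract_less_one_iff)
  ultimately show "r \<in> (\<Union>d\<in>{d. d dvd n}. proper_fracs d)"
    by (auto simp: proper_fracs_def)
qed

lemma sin_pi_rat_pos: "0 < r \<Longrightarrow> r < 1 \<Longrightarrow> sin (pi * real_of_rat r) > 0"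
  by (intro sin_gt_zero) auto

lemma prod_sin_proper_fracs_pos: "(\<Prod>r\<in>proper_fracs d. 2 * sin (pi * real_of_rat r)) > 0"
  by (intro prod_pos) (auto simp: proper_fracs_def intro!: sin_pi_rat_pos)

lemma prod_divisors_sin_proper_fracs:
  assumes "n > 0"
  shows "(\<Prod>d | d dvd n. \<Prod>r\<in>proper_fracs d. 2 * sin (pi * real_of_rat r)) = real n"
proof -
  have inj: "inj_on (\<lambda>k. Fract (int k) (int n)) {1..<n}"
    using assms by (auto intro!: inj_onI simp: eq_rat)
  have "(\<Prod>d | d dvd n. \<Prod>r\<in>proper_fracs d. 2 * sin (pi * real_of_rat r))
      = (\<Prod>r\<in>(\<Union>d\<in>{d. d dvd n}. proper_fracs d). 2 * sin (pi * real_of_rat r))"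
    using assms
    by (intro prod.UNION_disjoint[symmetric])
       (auto simp: finite_proper_fracs proper_fracs_disjoint)
  also have "\<dots> = (\<Prod>k\<in>{1..<n}. 2 * sin (pi * (real k / real n)))"
    unfolding UN_proper_fracs_dvd[OF assms] prod.reindex[OF inj]
    using assms by (simp add: of_rat_rat)
  finally show ?thesis
    using prod_sin_multiples[OF assms] by simp
qed

lemma prod_sin_proper_fracs:
  assumes "n > 0"
  shows "(\<Prod>r\<in>proper_fracs n. 2 * sin (pi * real_of_rat r)) = exp (mangoldt n)"
proof -
  define f where "f d = (\<Prod>r\<in>proper_fracs d. 2 * sin (pi * real_of_rat r))" for d
  have f_pos: "f d > 0" for d
    unfolding f_def by (rule prod_sin_proper_fracs_pos)
  have sum_f: "(\<Sum>d | d dvd m. ln (f d)) = ln (real m)" if "m > 0" for m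
  proof -
    have "ln (\<Prod>d | d dvd m. f d) = (\<Sum>d | d dvd m. ln (f d))"
      using f_pos that by (intro ln_prod) (auto simp: less_imp_neq[OF f_pos, symmetric])
    then show ?thesis
      using prod_divisors_sin_proper_fracs[OF that] by (simp add: f_def)
  qed
  have "ln (f n) = mangoldt n"
    using assms
  proof (induction n rule: less_induct)
    case (less n)
    \<comment> \<open>Both divisor sums equal \<open>ln n\<close> and, by induction, agree on the
      proper divisors; isolating the term at \<open>n\<close> forces equality there.\<close>
    have split: "{d. d dvd n} = insert n {d. d dvd n \<and> d < n}"
      using less.prems by (auto dest: dvd_imp_le)
    have fin: "finite {d. d dvd n \<and> d < n}" by simp
    have "(\<Sum>d | d dvd n. ln (f d)) = (\<Sum>d | d dvd n. mangoldt d)"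
      using sum_f[OF less.prems] mangoldt_sum[of n, where 'a = real] less.prems by simp
    moreover have "(\<Sum>d | d dvd n \<and> d < n. ln (f d)) = (\<Sum>d | d dvd n \<and> d < n. mangoldt d)"
      using less by (intro sum.cong) (auto intro: dvd_pos_nat)
    ultimately show ?case
      unfolding split using fin by simp
  qed
  then show ?thesis
    using f_pos[of n] by (metis exp_ln f_def)
qed

section \<open>The least common multiple and the von Mangoldt function\<close>

lemma prime_power_dvd_lcmD:
  fixes a b p :: nat
  assumes "prime p" "p ^ k dvd lcm a b" "a > 0" "b > 0"
  shows "p ^ k dvd a \<or> p ^ k dvd b"
proof -
  have "k \<le> multiplicity p (lcm a b)"
    using assms by (intro multiplicity_geI) auto
  \<comment> \<open>The multiplicity of \<open>p\<close> in an lcm is the larger of the two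
    multiplicities, so \<open>a\<close> or \<open>b\<close> attains it.\<close>
  then show ?thesis
    using assms by (auto simp: multiplicity_lcm max_def multiplicity_dvd' split: if_splits)
qed

text \<open>Peeling off one number at a time shows that a prime power dividing the lcm divides one
  of 1, ..., n. The case k = 0 would fail at n = 0, since \<open>Lcm {}\<close> is 1.\<close>

lemma prime_power_dvd_Lcm_imp_le:
  assumes "prime p" "p ^ k dvd Lcm {1..n::nat}" "k > 0"
  shows "p ^ k \<le> n"
  using assms(2)
proof (induction n)
  case 0
  then show ?case using assms by auto
next
  case (Suc n)
  have "Lcm {1..n} > 0"
    by (rule Nat.gr0I) simp
  moreover have "p ^ k dvd lcm (Suc n) (Lcm {1..n})"
    using Suc.prems by (simp add: atLeastAtMostSuc_conv)
  ultimately have "p ^ k dvd Suc n \<or> p ^ k dvd Lcm {1..n}"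
    using assms(1) by (intro prime_power_dvd_lcmD) auto
  then show ?case
    using Suc.IH by (auto dest: dvd_imp_le)
qed

text \<open>Only a prime power p^k = n + 1 enlarges the lcm: p^(k-1) already divides it and p^k does
  not, so exactly one factor p = exp(ln p) is gained.\<close>

lemma Lcm_atLeastAtMost_Suc:
  "real (Lcm {1..Suc n}) = real (Lcm {1..n}) * exp (mangoldt (Suc n))"
proof -
  define L where "L = Lcm {1..n}"
  have L_pos: "L > 0" unfolding L_def by (rule Nat.gr0I) simp
  have L_Suc: "Lcm {1..Suc n} = lcm (Suc n) L"
    by (simp add: L_def atLeastAtMostSuc_conv)
  show ?thesis
  proof (cases "primepow (Suc n)")
    case True
    then obtain p k where p: "prime p" "k > 0" "Suc n = p ^ k"
      by (auto simp: primepow_def)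
    obtain j where j: "k = Suc j" using p(2) by (cases k) auto
    have "p ^ j < p ^ k" using prime_gt_1_nat[OF p(1)] j by simp
    then have "p ^ j \<in> {1..n}"
      using p prime_gt_0_nat[OF p(1)] by (auto simp: Suc_le_eq)
    then have "p ^ j dvd L" unfolding L_def by (rule dvd_Lcm)
    then obtain c where c: "L = p ^ j * c" by auto
    \<comment> \<open>Since p^k = n + 1 exceeds n, it cannot divide \<open>L\<close>; hence the
      cofactor \<open>c\<close> of \<open>p ^ j\<close> is prime to \<open>p\<close>.\<close>
    have "\<not> p ^ k dvd L"
      using prime_power_dvd_Lcm_imp_le[OF p(1) _ p(2), of n] p(3) by (auto simp: L_def)
    then have "\<not> p dvd c" by (auto simp: c j mult.commute)
    then have "coprime p c" using p(1) by (rule prime_imp_coprime[rotated])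
    then have "lcm p c = p * c" by (simp add: lcm_coprime)
    have "lcm (Suc n) L = lcm (p ^ j * p) (p ^ j * c)"
      by (simp only: p(3) c j power_Suc2)
    also have "\<dots> = p ^ j * lcm p c" by (simp add: lcm_mult_left)
    also have "\<dots> = L * p"
      using \<open>lcm p c = p * c\<close> by (simp add: c)
    finally show ?thesis
      using p prime_gt_0_nat[OF p(1)] unfolding L_Suc by (simp add: L_def p(1,2,3) del: of_nat_Suc)
  next
    case False
    have "Suc n dvd L"
    proof (rule ccontr)
      \<comment> \<open>Some prime \<open>p\<close> would have a full power \<open>p ^ m\<close> in
        n + 1 not dividing \<open>L\<close>. As n + 1 is not a prime power, \<open>p ^ m\<close> is
        smaller than n + 1, hence among the numbers whose lcm is \<open>L\<close>.\<close>
      assume nd: "\<not> Suc n dvd L"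
      have "\<exists>p. prime p \<and> \<not> multiplicity p (Suc n) \<le> multiplicity p L"
        using nd multiplicity_le_imp_dvd[of "Suc n" L] L_pos by blast
      then obtain p where p: "prime p" "multiplicity p L < multiplicity p (Suc n)"
        by auto
      define m where "m = multiplicity p (Suc n)"
      have "p ^ m dvd Suc n" unfolding m_def by (rule multiplicity_dvd)
      moreover have "p ^ m \<noteq> Suc n"
        using False p by (metis m_def gr0I not_less0 primepow_prime_power)
      ultimately have "p ^ m \<in> {1..n}"
        using p prime_gt_0_nat[OF p(1)] dvd_imp_le[of "p ^ m" "Suc n"] by (auto simp: Suc_le_eq)
      then have "p ^ m dvd L" unfolding L_def by (rule dvd_Lcm)
      then have "m \<le> multiplicity p L"
        using p L_pos by (intro multiplicity_geI) auto
      then show False using p by (simp add: m_def)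
    qed
    then show ?thesis
      using False unfolding L_Suc by (simp add: L_def mangoldt_def lcm_proj2_if_dvd)
  qed
qed

lemma Lcm_eq_prod_exp_mangoldt: "real (Lcm {1..n}) = (\<Prod>d\<in>{1..n}. exp (mangoldt d))"
proof (induction n)
  case (Suc n)
  then show ?case
    by (simp only: Lcm_atLeastAtMost_Suc) simp
qed simp

lemma prod_sin_farey: "(\<Prod>r\<in>farey N. 2 * sin (pi * real_of_rat r)) = real (Lcm {1..N})"
proof -
  have "(\<Prod>r\<in>farey N. 2 * sin (pi * real_of_rat r))
      = (\<Prod>d\<in>{1..N}. \<Prod>r\<in>proper_fracs d. 2 * sin (pi * real_of_rat r))"
    unfolding farey_eq_UN
    by (intro prod.UNION_disjoint) (auto simp: finite_proper_fracs proper_fracs_disjoint)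
  then show ?thesis
    unfolding Lcm_eq_prod_exp_mangoldt by (simp add: prod_sin_proper_fracs)
qed

section \<open>Reflection and conclusion\<close>

lemma one_minus_in_farey:
  assumes "r \<in> farey N"
  shows "1 - r \<in> farey N"
proof -
  obtain a b where ab: "quotient_of r = (a, b)" by (cases "quotient_of r")
  have b: "b > 0" by (rule quotient_of_denom_pos[OF ab])
  have "r = Fract a b"
    using quotient_of_div[OF ab] by (simp add: Fract_of_int_quotient)
  then have "1 - r = Fract (b - a) b"
    using b by (simp add: One_rat_def)
  \<comment> \<open>gcd(b - a, b) = gcd(a, b), so the reduced denominator stays
    \<open>b\<close>.\<close>
  moreover have "coprime (b - a) b"
    using quotient_of_coprime[OF ab] by (simp add: coprime_iff_gcd_eq_1 gcd_diff2)
  ultimately have "quotient_of (1 - r) = (b - a, b)"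
    using b by (simp add: quotient_of_Fract)
  then show ?thesis
    using assms ab by (simp add: farey_def)
qed

lemma bij_betw_farey_one_minus: "bij_betw (\<lambda>r. 1 - r) (farey N) (farey N)"
  by (rule bij_betw_byWitness[where f' = "\<lambda>r. 1 - r"]) (auto intro: one_minus_in_farey)

text \<open>Valid even at integers: one of the two Gamma values is then taken at a pole, where it is
  0 by convention, and \<open>pi / 0\<close> is 0.\<close>

lemma Gamma_reflection_real: "Gamma x * Gamma (1 - x) = pi / sin (pi * x)" for x :: real
proof -
  have "complex_of_real (Gamma x * Gamma (1 - x)) = Gamma (of_real x) * Gamma (1 - of_real x)"
    by (metis Gamma_complex_of_real of_real_1 of_real_diff of_real_mult)
  also have "\<dots> = of_real (pi / sin (pi * x))"
    by (simp add: Gamma_reflection_complex sin_of_real[symmetric])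
  finally show ?thesis by (simp only: of_real_eq_iff)
qed

theorem mainTheorem2:
  fixes N :: nat
  assumes "N \<ge> 1"
  shows "(\<Prod>r\<in>farey N. Gamma (real_of_rat r) / sqrt (2 * pi)) = real (Lcm {1..N}) powr (- 1 / 2)"
proof -
  define g where "g r = Gamma (real_of_rat r) / sqrt (2 * pi)" for r
  define P where "P = (\<Prod>r\<in>farey N. g r)"
  have P_pos: "P > 0"
    unfolding P_def g_def by (intro prod_pos) (auto simp: farey_def intro!: divide_pos_pos Gamma_real_pos)
  \<comment> \<open>Reindexing one copy of \<open>P\<close> by the involution pairs
    \<open>g r\<close> with \<open>g (1 - r)\<close>. This determines only the square;
    \<open>P_pos\<close> later selects the positive root.\<close>
  have "P\<^sup>2 = (\<Prod>r\<in>farey N. g r) * (\<Prod>r\<in>farey N. g (1 - r))"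
    by (simp add: P_def power2_eq_square prod.reindex_bij_betw[OF bij_betw_farey_one_minus, of g])
  also have "\<dots> = (\<Prod>r\<in>farey N. g r * g (1 - r))"
    by (rule prod.distrib[symmetric])
  also have "\<dots> = (\<Prod>r\<in>farey N. inverse (2 * sin (pi * real_of_rat r)))"
  proof (rule prod.cong[OF refl])
    fix r
    \<comment> \<open>The two factors \<open>sqrt (2 * pi)\<close> combine to \<open>2 * pi\<close>,
      whose \<open>pi\<close> cancels the one from the reflection formula.\<close>
    have "g r * g (1 - r) = (Gamma (real_of_rat r) * Gamma (1 - real_of_rat r)) / (2 * pi)"
      by (simp add: g_def of_rat_diff)
    then show "g r * g (1 - r) = inverse (2 * sin (pi * real_of_rat r))"
      by (simp add: Gamma_reflection_real field_simps)
  qed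
  also have "\<dots> = inverse (real (Lcm {1..N}))"
    using prod_inversef[of "\<lambda>r. 2 * sin (pi * real_of_rat r)" "farey N"]
    by (simp only: o_def prod_sin_farey)
  finally have "P = sqrt (inverse (real (Lcm {1..N})))"
    using P_pos by (metis less_imp_le real_sqrt_unique)
  also have "\<dots> = real (Lcm {1..N}) powr (- 1 / 2)"
    by (simp add: real_sqrt_inverse powr_half_sqrt powr_minus)
  finally show ?thesis
    by (simp add: P_def g_def)
qed

end
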